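(* Let $(\overline{T}_t)_{t\in\mathbb{R}_{\ge 0}}$ be a semigroup of sublinear transition operators on $\mathscr{B}$. Then $(\overline{T}_t)_{t\ge 0}$ is uniformly continuous if and only if there is some bounded sublinear rate operator $\overline{Q}$ such that $$\overline{T}_t = e^{t\overline{Q}} = \lim_{n\to+\infty}\Bigl(I+\frac{t}{n}\overline{Q}\Bigr)^n\quad\text{for all } t\in\mathbb{R}_{\ge 0},$$ where the limit is taken with respect to $\|\cdot\|_{\mathrm b}$. Whenever this is the case, this rate operator is given by $$\overline{Q}=\lim_{t\searrow 0}\frac{\overline{T}_t-I}{t},$$ with the limit again taken with respect to $\|\cdot\|_{\mathrm b}$.
   Context: Let $\mathcal{X}$ be a nonempty countable (finite or countably infinite) set and let $\mathscr{B}$ be the real vector space of bounded functions $\mathcal{X}\to\mathbb{R}$, with norm $\|f\|_\infty=\sup\{|f(x)|: x\in\mathcal{X}\}$. Inequalities between functions are pointwise and a real number is identified with the corresponding constant function. An operator is a (possibly nonlinear) map $\mathscr{B}\to\mathscr{B}$; $I$ is the identity operator; sums and real multiples of operators are defined pointwise, products and powers are compositions. For an operator $A$, $\|A\|_{\mathrm s}=\sup\{\|Af\|_\infty/\|f\|_\infty : f\in\mathscr{B}, f\ne 0\}$; $A$ is bounded if $\|A\|_{\mathrm s}<+\infty$. On the vector space of bounded operators one uses the norm $\|A\|_{\mathrm b}=\|A0\|_\infty+\|A\|_{\mathrm s}$. A sublinear transition operator is an operator $\overline{T}$ such that $\overline{T}(\lambda f)=\lambda\overline{T}f$ for all $f\in\mathscr{B}$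 and real $\lambda\ge 0$; $\overline{T}(f+g)\le\overline{T}f+\overline{T}g$ for all $f,g\in\mathscr{B}$; and $\overline{T}f\le\sup f$ for all $f\in\mathscr{B}$. (Such operators are bounded.) A sublinear rate operator is an operator $\overline{Q}$ such that $\overline{Q}(\lambda f)=\lambda\overline{Q}f$ for all $f\in\mathscr{B}$ and real $\lambda\ge 0$; $\overline{Q}(f+g)\le\overline{Q}f+\overline{Q}g$ for all $f,g\in\mathscr{B}$; $\overline{Q}\mu=0$ for all constants $\mu\in\mathbb{R}$; and $[\overline{Q}f](x)\le 0$ for all $f\in\mathscr{B}$ and $x\in\mathcal{X}$ with $\sup f=f(x)\ge 0$. A semigroup is a family $(S_t)_{t\in\mathbb{R}_{\ge0}}$ of operators with $S_0=I$ and $S_{s+t}=S_sS_t$ for all $s,t\ge 0$. A semigroup of bounded operators is uniformly continuous if $\lim_{s\to t}\|S_s-S_t\|_{\mathrm b}=0$ for all $t\ge 0$. *)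

theory Defs
  imports "HOL-Analysis.Analysis" "HOL-Probability.Discrete_Topology"
begin

text \<open>
  Every set of the type \<open>'x discrete\<close> (a copy of \<open>'x\<close>) is open, so the bounded continuous
  functions on it are exactly the bounded functions on \<open>'x\<close>, and their norm is the supremum
  norm; the two lemmas below confirm this.
\<close>

type_synonym 'x bfun = "'x discrete \<Rightarrow>\<^sub>C real"

type_synonym 'x bop = "'x bfun \<Rightarrow> 'x bfun"

lemma bfun_iff_bounded:
  fixes f :: "'x discrete \<Rightarrow> real"
  shows "f \<in> bcontfun \<longleftrightarrow> bounded (range f)"
  by (auto simp: bcontfun_def continuous_on_open_vimage open_discrete)

lemma norm_bfun_eq_SUP:
  fixes f :: "'x bfun"
  shows "norm f = (SUP x. \<bar>f x\<bar>)"
  by (simp add: norm_bcontfun_def dist_bcontfun.rep_eq dist_real_def)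

text \<open>The norms of an operator take values in \<open>[0, \<infinity>]\<close>, with \<open>\<infinity>\<close> for unbounded operators.\<close>

definition op_norm_s :: "'x bop \<Rightarrow> ennreal" where
  "op_norm_s A = (SUP f\<in>{f. f \<noteq> 0}. ennreal (norm (A f) / norm f))"

definition op_bounded :: "'x bop \<Rightarrow> bool" where
  "op_bounded A \<longleftrightarrow> op_norm_s A < \<infinity>"

definition op_norm_b :: "'x bop \<Rightarrow> ennreal" where
  "op_norm_b A = ennreal (norm (A 0)) + op_norm_s A"

definition op_tendsto :: "('i \<Rightarrow> 'x bop) \<Rightarrow> 'x bop \<Rightarrow> 'i filter \<Rightarrow> bool" where
  "op_tendsto A L F \<longleftrightarrow> ((\<lambda>i. op_norm_b (\<lambda>f. A i f - L f)) \<longlongrightarrow> 0) F"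

definition op_lim :: "'i filter \<Rightarrow> ('i \<Rightarrow> 'x bop) \<Rightarrow> 'x bop" where
  "op_lim F A = (THE L. op_tendsto A L F)"

text \<open>
  The superscript \<open>^^\<close> is iterated composition. The value of \<open>op_exp\<close> is meaningful only if the
  limit exists.
\<close>

definition op_exp :: "'x bop \<Rightarrow> 'x bop" where
  "op_exp A = op_lim sequentially (\<lambda>n. (\<lambda>f. f + (1 / real n) *\<^sub>R A f) ^^ n)"

definition sublinear_transition_op :: "'x bop \<Rightarrow> bool" where
  "sublinear_transition_op T \<longleftrightarrow>
     (\<forall>f c. 0 \<le> c \<longrightarrow> T (c *\<^sub>R f) = c *\<^sub>R T f) \<and>
     (\<forall>f g x. T (f + g) x \<le> T f x + T g x) \<and>
     (\<forall>f x. T f x \<le> (SUP y. f y))"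

definition sublinear_rate_op :: "'x bop \<Rightarrow> bool" where
  "sublinear_rate_op Q \<longleftrightarrow>
     (\<forall>f c. 0 \<le> c \<longrightarrow> Q (c *\<^sub>R f) = c *\<^sub>R Q f) \<and>
     (\<forall>f g x. Q (f + g) x \<le> Q f x + Q g x) \<and>
     (\<forall>c. Q (const_bcontfun c) = 0) \<and>
     (\<forall>f x. (SUP y. apply_bcontfun f y) = apply_bcontfun f x \<and> 0 \<le> apply_bcontfun f x \<longrightarrow> Q f x \<le> 0)"

text \<open>Families are indexed by all reals, but only the indices \<open>t \<ge> 0\<close> matter.\<close>

definition op_semigroup :: "(real \<Rightarrow> 'x bop) \<Rightarrow> bool" where
  "op_semigroup S \<longleftrightarrow> S 0 = id \<and> (\<forall>s\<ge>0. \<forall>t\<ge>0. S (s + t) = S s \<circ> S t)"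

definition uniformly_continuous_semigroup :: "(real \<Rightarrow> 'x bop) \<Rightarrow> bool" where
  "uniformly_continuous_semigroup S \<longleftrightarrow> (\<forall>t\<ge>0. op_tendsto S (S t) (at t within {0..}))"

text \<open>\<open>T\<^sub>t = exp (t Q) = lim (I + t/n Q)\<^sup>n\<close> for all \<open>t \<ge> 0\<close>, including the existence of the limit.\<close>

definition exponential_semigroup_of :: "'x bop \<Rightarrow> (real \<Rightarrow> 'x bop) \<Rightarrow> bool" where
  "exponential_semigroup_of Q T \<longleftrightarrow>
     (\<forall>t\<ge>0. T t = op_exp (\<lambda>f. t *\<^sub>R Q f) \<and>
        op_tendsto (\<lambda>n. (\<lambda>f. f + (t / real n) *\<^sub>R Q f) ^^ n) (T t) sequentially)"

end

theory Submission
  imports Defs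
begin

text \<open>
  Everything rests on the fact that a sublinear operator \<open>A\<close> with \<open>\<parallel>A f\<parallel> \<le> c \<parallel>f\<parallel>\<close> is Lipschitz
  with the same constant \<open>c\<close>, because \<open>A f - A g \<le> A (f - g)\<close>. Applied to \<open>A\<^sub>t = T\<^sub>t - I\<close>, whose
  norm \<open>\<epsilon>\<^sub>t\<close> tends to \<open>0\<close>, and combined with the telescoping sum
  \<open>A\<^bsub>nt\<^esub> = \<Sum>k<n. A\<^sub>t T\<^bsub>kt\<^esub>\<close>, it gives \<open>\<parallel>A\<^bsub>nt\<^esub> - n A\<^sub>t\<parallel> \<le> n \<epsilon>\<^sub>t max\<^sub>k \<epsilon>\<^bsub>kt\<^esub>\<close>. This first forces
  \<open>\<epsilon>\<^sub>t \<le> C t\<close>, and then makes \<open>A\<^sub>t / t\<close> converge, with error at most \<open>C\<^sup>2 t\<close>, to a bounded rate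
  operator \<open>Q\<close>. Since \<open>I + h Q\<close> is Lipschitz with constant \<open>1 + h C\<close> and differs from \<open>T\<^sub>h\<close> by
  \<open>O(h\<^sup>2)\<close>, the Euler scheme converges to \<open>T\<^sub>t\<close>. Conversely, the Euler iterates of any Lipschitz
  \<open>Q\<close> with \<open>Q 0 = 0\<close> satisfy explicit bounds for \<open>(I + h Q)\<^sup>n - I\<close> and \<open>(I + h Q)\<^sup>n - I - n h Q\<close>,
  and these pass to the limit.
\<close>

section \<open>Convergence of operators\<close>

lemma op_norm_b_le:
  assumes "A 0 = 0" "0 \<le> c" "\<And>f. norm (A f) \<le> c * norm f"
  shows "op_norm_b A \<le> ennreal c"
proof -
  have "op_norm_s A \<le> ennreal c"
    unfolding op_norm_s_def
    by (rule SUP_least) (use assms in \<open>auto intro!: ennreal_leI simp: pos_divide_le_eq\<close>)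
  with assms(1) show ?thesis
    by (simp add: op_norm_b_def)
qed

text \<open>The supremum in \<open>op_norm_s\<close> skips \<open>f = 0\<close>, so the value at
  \<open>0\<close> is controlled only by the other summand of \<open>op_norm_b\<close>; hence the
  two conclusions.\<close>

lemma norm_le_of_op_norm_b:
  assumes "op_norm_b A \<le> ennreal c" "0 \<le> c"
  shows "norm (A 0) \<le> c" "f \<noteq> 0 \<Longrightarrow> norm (A f) \<le> c * norm f"
proof -
  have "ennreal (norm (A 0)) \<le> op_norm_b A"
    by (simp add: op_norm_b_def)
  then have "ennreal (norm (A 0)) \<le> ennreal c"
    using assms(1) by (rule order_trans)
  with assms show "norm (A 0) \<le> c" by simp
next
  assume f: "f \<noteq> 0"
  have "ennreal (norm (A f) / norm f) \<le> op_norm_s A"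
    unfolding op_norm_s_def by (rule SUP_upper) (use f in simp)
  also have "\<dots> \<le> op_norm_b A"
    by (simp add: op_norm_b_def)
  also note assms(1)
  finally show "norm (A f) \<le> c * norm f"
    using f assms(2) by (simp add: pos_divide_le_eq)
qed

lemma op_tendstoI:
  assumes "\<forall>\<^sub>F i in F. A i 0 = L 0 \<and> 0 \<le> c i \<and> (\<forall>f. norm (A i f - L f) \<le> c i * norm f)"
    and "(c \<longlongrightarrow> 0) F"
  shows "op_tendsto A L F"
  unfolding op_tendsto_def
proof (rule tendsto_sandwich[where f = "\<lambda>_. 0"])
  show "\<forall>\<^sub>F i in F. op_norm_b (\<lambda>f. A i f - L f) \<le> ennreal (c i)"
    using assms(1) by eventually_elim (rule op_norm_b_le, auto)
  show "((\<lambda>i. ennreal (c i)) \<longlongrightarrow> 0) F"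
    using tendsto_ennrealI[OF assms(2)] by simp
qed auto

lemma op_tendstoD:
  assumes "op_tendsto A L F" "0 < e"
  shows "\<forall>\<^sub>F i in F. norm (A i 0 - L 0) \<le> e \<and> (\<forall>f. f \<noteq> 0 \<longrightarrow> norm (A i f - L f) \<le> e * norm f)"
proof -
  have "\<forall>\<^sub>F i in F. op_norm_b (\<lambda>f. A i f - L f) < ennreal e"
    using assms unfolding op_tendsto_def by (intro order_tendstoD(2)) auto
  then show ?thesis
    using norm_le_of_op_norm_b[of "\<lambda>f. A _ f - L f" e] assms(2)
    by (auto elim!: eventually_mono intro: less_imp_le)
qed

lemma op_tendsto_pointwise:
  assumes "op_tendsto A L F"
  shows "((\<lambda>i. A i f) \<longlongrightarrow> L f) F"
proof (rule tendstoI)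
  fix e :: real assume e: "0 < e"
  \<comment> \<open>This choice makes both \<open>d\<close> and \<open>d * norm f\<close> smaller
    than \<open>e\<close>; the former serves the case \<open>f = 0\<close>.\<close>
  define d where "d = e / 2 / (1 + norm f)"
  have n: "0 < 1 + norm f" by (simp add: add_pos_nonneg)
  then have d: "0 < d" using e by (simp add: d_def)
  have "d * (1 + norm f) = e / 2"
    unfolding d_def using n by (intro nonzero_eq_divide_eq[THEN iffD1, OF _ refl]) linarith
  then have "d + d * norm f < e"
    using e by (simp add: distrib_left)
  moreover have "0 \<le> d * norm f"
    using d by simp
  ultimately have "d * norm f < e" "d < e"
    using d by linarith+
  with op_tendstoD[OF assms d] show "\<forall>\<^sub>F i in F. dist (A i f) (L f) < e"
    by (elim eventually_mono) (cases "f = 0"; force simp: dist_norm)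
qed

lemma op_tendsto_unique:
  assumes "op_tendsto A L F" "op_tendsto A L' F" "F \<noteq> bot"
  shows "L = L'"
  using assms by (intro ext tendsto_unique[OF _ op_tendsto_pointwise op_tendsto_pointwise])

lemma op_lim_eq:
  assumes "op_tendsto A L F" "F \<noteq> bot"
  shows "op_lim F A = L"
  unfolding op_lim_def using assms op_tendsto_unique by blast

section \<open>Euler iterates of Lipschitz maps\<close>

text \<open>The Euler estimates rest on these three properties alone, so they are set in an
  arbitrary normed space.\<close>

locale lipschitz_map =
  fixes Q :: "'a::real_normed_vector \<Rightarrow> 'a" and L :: real
  assumes lipschitz: "norm (Q f - Q g) \<le> L * norm (f - g)"
    and zero: "Q 0 = 0"
    and nonneg: "0 \<le> L"
begin

abbreviation euler :: "real \<Rightarrow> 'a \<Rightarrow> 'a" where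
  "euler h \<equiv> \<lambda>f. f + h *\<^sub>R Q f"

lemma norm_le: "norm (Q f) \<le> L * norm f"
  using lipschitz[of f 0] by (simp add: zero)

lemma euler_pow_zero: "(euler h ^^ n) 0 = 0"
  by (induction n) (auto simp: zero)

text \<open>Iterates grow by at most the factor \<open>1 + h * L\<close> per step, so the successive
  displacements are dominated by a geometric progression, whose sum is the bound.\<close>

lemma euler_pow_minus_id:
  assumes h: "0 \<le> h"
  shows "norm ((euler h ^^ n) f - f) \<le> ((1 + h * L) ^ n - 1) * norm f"
proof (induction n)
  case (Suc n)
  let ?g = "(euler h ^^ n) f"
  have "norm ?g \<le> norm (?g - f) + norm f"
    using norm_triangle_ineq[of "?g - f" f] by simp
  also have "\<dots> \<le> (1 + h * L) ^ n * norm f"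
    using Suc by (simp add: algebra_simps)
  finally have "norm (h *\<^sub>R Q ?g) \<le> h * (L * ((1 + h * L) ^ n * norm f))"
    using h by (auto intro!: mult_left_mono order_trans[OF norm_le] nonneg)
  with Suc have "norm (?g - f + h *\<^sub>R Q ?g)
      \<le> ((1 + h * L) ^ n - 1) * norm f + h * (L * ((1 + h * L) ^ n * norm f))"
    by (intro norm_triangle_mono)
  then show ?case
    by (simp add: algebra_simps)
qed simp

text \<open>A step from \<open>g\<close> deviates from \<open>h *\<^sub>R Q f\<close> by at most
  \<open>h * L\<close> times the distance of \<open>g\<close> from \<open>f\<close>. The previous
  lemma bounds that distance, and its largest value is used for all \<open>n\<close> steps.\<close>

lemma euler_pow_minus_linear:
  assumes h: "0 \<le> h"
  shows "norm ((euler h ^^ n) f - f - (n * h) *\<^sub>R Q f)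
    \<le> n * h * L * ((1 + h * L) ^ n - 1) * norm f"
proof (induction n)
  case (Suc n)
  let ?g = "(euler h ^^ n) f"
  let ?p = "\<lambda>n. (1 + h * L) ^ n - 1"
  have mono: "?p n \<le> ?p (Suc n)"
    using h nonneg power_increasing[of n "Suc n" "1 + h * L"] by simp
  have "norm (h *\<^sub>R (Q ?g - Q f)) \<le> h * (L * (?p n * norm f))"
    using h nonneg euler_pow_minus_id[OF h, of n f]
    by (auto intro!: mult_left_mono order_trans[OF lipschitz])
  with Suc have "norm ((?g - f - (n * h) *\<^sub>R Q f) + h *\<^sub>R (Q ?g - Q f))
      \<le> n * h * L * ?p n * norm f + h * (L * (?p n * norm f))"
    by (intro norm_triangle_mono)
  also have "\<dots> = (Suc n * h * L * norm f) * ?p n"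
    by (simp add: algebra_simps)
  also have "\<dots> \<le> (Suc n * h * L * norm f) * ?p (Suc n)"
    using h nonneg by (intro mult_left_mono mono) auto
  finally show ?case
    by (simp add: algebra_simps)
qed simp

lemma euler_factor_le_exp:
  assumes "0 \<le> h"
  shows "(1 + h * L) ^ n \<le> exp (n * h * L)"
proof -
  have "(1 + h * L) ^ n \<le> exp (h * L) ^ n"
    using assms nonneg by (intro power_mono) auto
  then show ?thesis
    by (simp add: exp_of_nat_mult[symmetric] mult.assoc)
qed

lemma euler_limit_bounds:
  assumes t: "0 \<le> t" and lim: "(\<lambda>n. (euler (t / real n) ^^ n) f) \<longlonglongrightarrow> S f"
  shows "norm (S f - f) \<le> (exp (t * L) - 1) * norm f"
    and "norm (S f - f - t *\<^sub>R Q f) \<le> t * L * (exp (t * L) - 1) * norm f"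
proof -
  \<comment> \<open>Here \<open>1 \<le> n\<close> ensures that \<open>n * (t / n)\<close> is
    \<open>t\<close>; for \<open>n = 0\<close> the quotient would be \<open>0\<close>.\<close>
  have factor: "(1 + t / n * L) ^ n - 1 \<le> exp (t * L) - 1" if "1 \<le> n" for n
    using euler_factor_le_exp[of "t / n" n] t that by simp
  have "\<forall>\<^sub>F n in sequentially.
      norm ((euler (t / real n) ^^ n) f - f) \<le> (exp (t * L) - 1) * norm f"
    using eventually_ge_at_top[of 1]
    by eventually_elim
      (rule order_trans[OF euler_pow_minus_id], use t factor in \<open>auto intro!: mult_right_mono\<close>)
  then show "norm (S f - f) \<le> (exp (t * L) - 1) * norm f"
    by (rule tendsto_upperbound[rotated]) (auto intro!: tendsto_intros lim)
  have "\<forall>\<^sub>F n in sequentially.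
      norm ((euler (t / real n) ^^ n) f - f - t *\<^sub>R Q f) \<le> t * L * (exp (t * L) - 1) * norm f"
    using eventually_ge_at_top[of 1]
  proof eventually_elim
    case (elim n)
    then have "norm ((euler (t / real n) ^^ n) f - f - t *\<^sub>R Q f)
        \<le> t * L * ((1 + t / n * L) ^ n - 1) * norm f"
      using euler_pow_minus_linear[of "t / n" n f] t by simp
    also have "\<dots> \<le> t * L * (exp (t * L) - 1) * norm f"
      using t nonneg factor elim by (intro mult_right_mono mult_left_mono) auto
    finally show ?case .
  qed
  then show "norm (S f - f - t *\<^sub>R Q f) \<le> t * L * (exp (t * L) - 1) * norm f"
    by (rule tendsto_upperbound[rotated]) (auto intro!: tendsto_intros lim)
qed

text \<open>A discrete Gronwall argument: the local error is at most \<open>D h\<^sup>2\<close> and is amplified by at most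
  \<open>1 + h L\<close> in each step.\<close>

lemma euler_error:
  assumes h: "0 \<le> h" and D: "0 \<le> D"
    and local: "\<And>g. norm (S g - euler h g) \<le> D * h\<^sup>2 * norm g"
    and contraction: "\<And>g. norm (S g) \<le> norm g"
  shows "norm ((S ^^ n) f - (euler h ^^ n) f) \<le> n * (D * h\<^sup>2) * exp (n * h * L) * norm f"
proof -
  have pow: "norm ((S ^^ n) f) \<le> norm f" for n
    by (induction n) (auto intro: order_trans[OF contraction])
  have "norm ((S ^^ n) f - (euler h ^^ n) f) \<le> n * (D * h\<^sup>2) * (1 + h * L) ^ n * norm f"
  proof (induction n)
    case (Suc n)
    let ?u = "(S ^^ n) f" and ?v = "(euler h ^^ n) f" and ?p = "\<lambda>n. (1 + h * L) ^ n"
    have p: "1 \<le> ?p (Suc n)"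
      using h nonneg by (intro one_le_power) simp
    have 1: "norm (S ?u - euler h ?u) \<le> D * h\<^sup>2 * norm f"
      using D by (auto intro!: order_trans[OF local] mult_left_mono pow)
    have "norm (euler h ?u - euler h ?v) \<le> norm (?u - ?v) + h * (L * norm (?u - ?v))"
    proof -
      have "euler h ?u - euler h ?v = (?u - ?v) + h *\<^sub>R (Q ?u - Q ?v)"
        by (simp add: algebra_simps)
      also have "norm \<dots> \<le> norm (?u - ?v) + h * (L * norm (?u - ?v))"
        using h by (intro norm_triangle_mono) (auto intro!: mult_left_mono lipschitz)
      finally show ?thesis .
    qed
    also have "\<dots> = (1 + h * L) * norm (?u - ?v)"
      by (simp add: algebra_simps)
    also have "\<dots> \<le> (1 + h * L) * (n * (D * h\<^sup>2) * ?p n * norm f)"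
      using h nonneg by (intro mult_left_mono Suc) auto
    finally have 2: "norm (euler h ?u - euler h ?v) \<le> n * (D * h\<^sup>2) * ?p (Suc n) * norm f"
      by (simp add: algebra_simps)
    \<comment> \<open>Inserting an Euler step from \<open>?u\<close> separates the new local error
      from the propagated old one.\<close>
    have "norm ((S ^^ Suc n) f - (euler h ^^ Suc n) f)
        = norm ((S ?u - euler h ?u) + (euler h ?u - euler h ?v))"
      by (simp only: funpow.simps comp_apply add_diff_eq diff_add_cancel)
    also have "\<dots> \<le> D * h\<^sup>2 * norm f + n * (D * h\<^sup>2) * ?p (Suc n) * norm f"
      by (intro norm_triangle_mono 1 2)
    \<comment> \<open>The new error also receives the factor \<open>?p (Suc n)\<close>, which is at
      least 1, so that the two terms combine.\<close>
    also have "\<dots> \<le> (D * h\<^sup>2 * norm f) * ?p (Suc n) + n * (D * h\<^sup>2) * ?p (Suc n) * norm f"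
      using mult_left_mono[OF p, of "D * h\<^sup>2 * norm f"] D by simp
    also have "\<dots> = Suc n * (D * h\<^sup>2) * ?p (Suc n) * norm f"
      by (simp add: algebra_simps)
    finally show ?case .
  qed simp
  also have "\<dots> \<le> n * (D * h\<^sup>2) * exp (n * h * L) * norm f"
    using D h by (intro mult_right_mono mult_left_mono euler_factor_le_exp) auto
  finally show ?thesis .
qed

end

section \<open>Sublinear operators\<close>

lemma subadditive_op_lipschitz:
  fixes A :: "'x bop"
  assumes sub: "\<And>f g x. A (f + g) x \<le> A f x + A g x"
    and bound: "\<And>f. norm (A f) \<le> c * norm f"
  shows "norm (A f - A g) \<le> c * norm (f - g)"
proof (rule norm_bound)
  fix x
  have *: "A f x - A g x \<le> c * norm (f - g)" for f g
    using sub[of "f - g" g x] norm_bounded[of "A (f - g)" x] bound[of "f - g"] by simp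
  show "norm ((A f - A g) x) \<le> c * norm (f - g)"
    using *[of f g] *[of g f] by (simp add: abs_le_iff norm_minus_commute)
qed

lemma bcontfun_SUP_le_norm: "(SUP y. apply_bcontfun (f :: 'x bfun) y) \<le> norm f"
  using norm_bounded[of f] by (intro cSUP_least) (auto intro: order_trans[OF abs_ge_self])

context
  fixes T :: "'x bop"
  assumes T: "sublinear_transition_op T"
begin

lemma sublinear_transition_zero: "T 0 = 0"
proof -
  have "T (0 *\<^sub>R 0) = 0 *\<^sub>R T 0"
    using T unfolding sublinear_transition_op_def by blast
  then show ?thesis by simp
qed

lemma sublinear_transition_add: "T (f + g) x \<le> T f x + T g x"
  using T unfolding sublinear_transition_op_def by blast

lemma sublinear_transition_le_SUP: "T f x \<le> (SUP y. f y)"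
  using T unfolding sublinear_transition_op_def by blast

text \<open>The supremum bound gives only an upper estimate. The lower one comes from
  \<open>0 = T (f + (- f))\<close>, which is at most \<open>T f + T (- f)\<close>.\<close>

lemma sublinear_transition_norm_le: "norm (T f) \<le> norm f"
proof (rule norm_bound)
  fix x
  have "T f x \<le> norm f" for f
    using sublinear_transition_le_SUP bcontfun_SUP_le_norm by (rule order_trans)
  from this[of f] this[of "- f"] sublinear_transition_add[of f "- f" x]
  show "norm (T f x) \<le> norm f"
    by (simp add: sublinear_transition_zero abs_le_iff)
qed

lemma sublinear_transition_nonexpansive: "norm (T f - T g) \<le> norm (f - g)"
  using subadditive_op_lipschitz[of T 1, OF sublinear_transition_add] sublinear_transition_norm_le
  by simp

lemma sublinear_transition_const: "T (const_bcontfun c) = const_bcontfun c"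
proof (rule bcontfun_eqI)
  fix x
  have "T (const_bcontfun c) x \<le> c" for c
    using sublinear_transition_le_SUP[of "const_bcontfun c" x] by simp
  moreover have "const_bcontfun c + const_bcontfun (- c) = (0 :: 'x bfun)"
    by (rule bcontfun_eqI) simp
  ultimately show "T (const_bcontfun c) x = const_bcontfun c x"
    using sublinear_transition_add[of "const_bcontfun c" "const_bcontfun (- c)" x]
    by (simp add: sublinear_transition_zero) (smt (verit))
qed

end

text \<open>Finiteness of \<open>op_norm_b Q\<close> supplies a real constant, and subadditivity
  turns the norm bound into a Lipschitz bound. This makes the Euler estimates available for
  \<open>Q\<close>.\<close>

lemma sublinear_rate_op_lipschitz_map:
  fixes Q :: "'x bop"
  assumes Q: "sublinear_rate_op Q" and bdd: "op_bounded Q"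
  obtains L where "lipschitz_map Q L"
proof -
  have zero: "Q 0 = 0"
    using Q const_bcontfun_0_eq_0 unfolding sublinear_rate_op_def by metis
  have "op_norm_b Q < \<infinity>"
    using bdd by (simp add: op_norm_b_def op_bounded_def zero)
  then obtain L where L: "op_norm_b Q = ennreal L" "0 \<le> L"
    by (cases "op_norm_b Q") auto
  have "norm (Q f) \<le> L * norm f" for f
    using norm_le_of_op_norm_b(2)[of Q L f] L by (cases "f = 0") (auto simp: zero)
  moreover have "Q (f + g) x \<le> Q f x + Q g x" for f g x
    using Q unfolding sublinear_rate_op_def by blast
  ultimately have "lipschitz_map Q L"
    using subadditive_op_lipschitz[of Q L] zero L(2) by unfold_locales auto
  with that show thesis .
qed

section \<open>Sublinear Markov semigroups\<close>

text \<open>Used to approximate a time \<open>s\<close> by a positive multiple of a shorter time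
  \<open>t\<close>, with remainder at most \<open>t\<close>.\<close>

lemma real_div_with_remainder:
  fixes s t :: real
  assumes "0 < t" "t \<le> s"
  obtains n :: nat where "0 < n" "n * t \<le> s" "s \<le> n * t + t"
proof
  have "1 \<le> s / t" using assms by simp
  then have n: "real (nat \<lfloor>s / t\<rfloor>) = of_int \<lfloor>s / t\<rfloor>" and "0 < nat \<lfloor>s / t\<rfloor>"
    by simp_all
  then show "0 < nat \<lfloor>s / t\<rfloor>" by simp
  have "of_int \<lfloor>s / t\<rfloor> \<le> s / t" "s / t \<le> of_int \<lfloor>s / t\<rfloor> + 1"
    by linarith+
  then have "of_int \<lfloor>s / t\<rfloor> * t \<le> s" "s \<le> (of_int \<lfloor>s / t\<rfloor> + 1) * t"
    using assms(1) by (simp_all only: pos_le_divide_eq pos_divide_le_eq)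
  then show "real (nat \<lfloor>s / t\<rfloor>) * t \<le> s" "s \<le> real (nat \<lfloor>s / t\<rfloor>) * t + t"
    by (simp_all only: n distrib_right mult_1)
qed

locale sublinear_semigroup =
  fixes T :: "real \<Rightarrow> 'x bop"
  assumes semigroup: "op_semigroup T"
    and transition: "0 \<le> t \<Longrightarrow> sublinear_transition_op (T t)"
begin

lemma T_0 [simp]: "T 0 f = f"
  using semigroup by (simp add: op_semigroup_def)

lemma T_add: "0 \<le> s \<Longrightarrow> 0 \<le> t \<Longrightarrow> T (s + t) f = T s (T t f)"
  using semigroup by (simp add: op_semigroup_def)

lemma T_zero: "0 \<le> t \<Longrightarrow> T t 0 = 0"
  by (rule sublinear_transition_zero[OF transition])

lemma T_norm_le: "0 \<le> t \<Longrightarrow> norm (T t f) \<le> norm f"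
  by (rule sublinear_transition_norm_le[OF transition])

lemma T_mult: "0 \<le> h \<Longrightarrow> T (n * h) = T h ^^ n"
proof (induction n)
  case (Suc n)
  then show ?case
    using T_add[of h "n * h"] by (auto simp: fun_eq_iff algebra_simps)
qed auto

text \<open>Nonexpansiveness of \<open>T\<^sub>s\<close> reduces continuity at \<open>s\<close> to continuity at \<open>0\<close>.\<close>

lemma T_diff_le:
  assumes "0 \<le> s" "0 \<le> t" and bound: "\<And>r. 0 \<le> r \<Longrightarrow> norm (T r f - f) \<le> w r"
  shows "norm (T s f - T t f) \<le> w \<bar>s - t\<bar>"
proof -
  have *: "norm (T (t + r) f - T t f) \<le> w r" if "0 \<le> t" "0 \<le> r" for t r
    using T_add[of t r f] that
      order_trans[OF sublinear_transition_nonexpansive[OF transition] bound, of t r]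
    by simp
  show ?thesis
    using *[of t "s - t"] *[of s "t - s"] assms(1,2)
    by (cases "t \<le> s") (auto simp: norm_minus_commute)
qed

section \<open>Exponential semigroups: continuity and derivative at zero\<close>

lemma exponential_bounds:
  assumes exp: "exponential_semigroup_of Q T" and Q: "lipschitz_map Q L" and t: "0 \<le> t"
  shows "norm (T t f - f) \<le> (exp (t * L) - 1) * norm f"
    and "norm (T t f - f - t *\<^sub>R Q f) \<le> t * L * (exp (t * L) - 1) * norm f"
proof -
  have "op_tendsto (\<lambda>n. (\<lambda>f. f + (t / real n) *\<^sub>R Q f) ^^ n) (T t) sequentially"
    using exp t unfolding exponential_semigroup_of_def by blast
  from lipschitz_map.euler_limit_bounds[OF Q t, where S = "T t", OF op_tendsto_pointwise[OF this]]
  show "norm (T t f - f) \<le> (exp (t * L) - 1) * norm f"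
    and "norm (T t f - f - t *\<^sub>R Q f) \<le> t * L * (exp (t * L) - 1) * norm f"
    by auto
qed

lemma exponential_uniformly_continuous:
  assumes "exponential_semigroup_of Q T" "lipschitz_map Q L"
  shows "uniformly_continuous_semigroup T"
  unfolding uniformly_continuous_semigroup_def
proof (intro allI impI)
  fix t :: real assume t: "0 \<le> t"
  have L: "0 \<le> L"
    using assms(2) by (rule lipschitz_map.nonneg)
  show "op_tendsto T (T t) (at t within {0..})"
  proof (rule op_tendstoI)
    show "((\<lambda>s. exp (\<bar>s - t\<bar> * L) - 1) \<longlongrightarrow> 0) (at t within {0..})"
      by (auto intro!: tendsto_eq_intros)
    have "\<forall>\<^sub>F s in at t within {0..}. 0 \<le> s"
      by (auto simp: eventually_at_filter)
    then show "\<forall>\<^sub>F s in at t within {0..}. T s 0 = T t 0 \<and> 0 \<le> exp (\<bar>s - t\<bar> * L) - 1 \<and>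
        (\<forall>f. norm (T s f - T t f) \<le> (exp (\<bar>s - t\<bar> * L) - 1) * norm f)"
    proof eventually_elim
      case (elim s)
      have "norm (T s f - T t f) \<le> (exp (\<bar>s - t\<bar> * L) - 1) * norm f" for f
        using T_diff_le[OF elim t, of f "\<lambda>r. (exp (r * L) - 1) * norm f"] exponential_bounds(1)[OF assms]
        by blast
      then show ?case
        using L elim t by (simp add: T_zero)
    qed
  qed
qed

text \<open>Dividing the second-order bound of \<open>exponential_bounds\<close> by \<open>t\<close>
  leaves the factor \<open>exp (t * L) - 1\<close>, which vanishes at \<open>0\<close>.\<close>

lemma exponential_derivative:
  assumes "exponential_semigroup_of Q T" "lipschitz_map Q L"
  shows "op_tendsto (\<lambda>t f. (1 / t) *\<^sub>R (T t f - f)) Q (at_right 0)"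
proof (rule op_tendstoI)
  interpret lipschitz_map Q L by fact
  show "((\<lambda>t. L * (exp (t * L) - 1)) \<longlongrightarrow> 0) (at_right 0)"
    by (auto intro!: tendsto_eq_intros)
  show "\<forall>\<^sub>F t in at_right 0. (1 / t) *\<^sub>R (T t 0 - 0) = Q 0 \<and> 0 \<le> L * (exp (t * L) - 1) \<and>
      (\<forall>f. norm ((1 / t) *\<^sub>R (T t f - f) - Q f) \<le> L * (exp (t * L) - 1) * norm f)"
    using eventually_at_right_less[of 0]
  proof eventually_elim
    case (elim t)
    have "norm ((1 / t) *\<^sub>R (T t f - f) - Q f) \<le> L * (exp (t * L) - 1) * norm f" for f
    proof -
      have "(1 / t) *\<^sub>R (T t f - f) - Q f = (1 / t) *\<^sub>R (T t f - f - t *\<^sub>R Q f)"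
        using elim by (simp add: scaleR_diff_right)
      also have "norm \<dots> = norm (T t f - f - t *\<^sub>R Q f) / t"
        using elim by simp
      also have "\<dots> \<le> L * (exp (t * L) - 1) * norm f"
        using exponential_bounds(2)[OF assms, of t f] elim by (simp add: pos_divide_le_eq mult_ac)
      finally show ?thesis .
    qed
    with elim nonneg show ?case
      by (simp add: T_zero zero)
  qed
qed

section \<open>The rate operator of a uniformly continuous semigroup\<close>

text \<open>Subtracting the identity, which is linear, preserves subadditivity.\<close>

lemma increment_lipschitz:
  assumes "0 \<le> t" "\<And>f. norm (T t f - f) \<le> c * norm f"
  shows "norm ((T t f - f) - (T t g - g)) \<le> c * norm (f - g)"
  using subadditive_op_lipschitz[of "\<lambda>f. T t f - f" c f g] assms(2)
    sublinear_transition_add[OF transition[OF assms(1)]] by (simp add: algebra_simps)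

text \<open>The summand of the telescoping sum that starts at \<open>T (k * t) f\<close> differs
  from \<open>T t f - f\<close> by at most \<open>c\<close> times the displacement of its starting
  point. The bound \<open>d\<close> concerns this one \<open>f\<close>, so callers put the factor
  \<open>norm f\<close> into it.\<close>

lemma increment_mult:
  fixes n :: nat and t c d :: real
  assumes t: "0 \<le> t" and c: "0 \<le> c" and Tt: "\<And>f. norm (T t f - f) \<le> c * norm f"
    and d: "\<forall>k<n. norm (T (real k * t) f - f) \<le> d"
  shows "norm ((T (n * t) f - f) - n *\<^sub>R (T t f - f)) \<le> n * (c * d)"
  using d
proof (induction n)
  case (Suc n)
  let ?g = "T (n * t) f"
  have "norm ((T t ?g - ?g) - (T t f - f)) \<le> c * norm (?g - f)"
    by (rule increment_lipschitz[OF t Tt])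
  also have "\<dots> \<le> c * d"
    using Suc.prems c by (intro mult_left_mono) auto
  finally have 1: "norm ((T t ?g - ?g) - (T t f - f)) \<le> c * d" .
  have 2: "norm ((?g - f) - n *\<^sub>R (T t f - f)) \<le> n * (c * d)"
    using Suc.prems by (intro Suc.IH) auto
  have "T (Suc n * t) f = T t ?g"
    using t T_add[of t "n * t" f] by (simp add: algebra_simps)
  then have "(T (Suc n * t) f - f) - Suc n *\<^sub>R (T t f - f)
      = ((?g - f) - n *\<^sub>R (T t f - f)) + ((T t ?g - ?g) - (T t f - f))"
    by (simp add: algebra_simps)
  then show ?case
    using norm_triangle_mono[OF 2 1] by (simp add: algebra_simps)
qed simp

text \<open>Continuity at \<open>0\<close> bounds all increments up to a time \<delta> by 1/2.
  Splitting a time close to \<delta> into \<open>n\<close> steps of length \<open>t\<close> then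
  forces each step to be of order \<open>1 / n\<close>, that is, of order \<open>t\<close>.\<close>

lemma uniformly_continuous_imp_linear_bound:
  assumes "uniformly_continuous_semigroup T"
  obtains C where "0 < C" "\<And>t f. 0 \<le> t \<Longrightarrow> norm (T t f - f) \<le> C * t * norm f"
proof -
  have "op_tendsto T (T 0) (at 0 within {0..})"
    using assms by (simp add: uniformly_continuous_semigroup_def)
  from op_tendstoD[OF this, of "1 / 2"]
  have "\<forall>\<^sub>F t in at 0 within {0..}. \<forall>f. f \<noteq> 0 \<longrightarrow> norm (T t f - f) \<le> 1 / 2 * norm f"
    by (auto elim: eventually_mono)
  then obtain \<delta>' where \<delta>': "0 < \<delta>'"
    "\<And>t f. 0 \<le> t \<Longrightarrow> t \<noteq> 0 \<Longrightarrow> t < \<delta>' \<Longrightarrow> f \<noteq> 0 \<Longrightarrow> norm (T t f - f) \<le> 1 / 2 * norm f"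
    by (auto simp: eventually_at)
  \<comment> \<open>Halving places the closed interval up to \<delta> inside the half-open one just
    obtained.\<close>
  define \<delta> where "\<delta> = \<delta>' / 2"
  have \<delta>: "0 < \<delta>" using \<delta>'(1) by (simp add: \<delta>_def)
  have half: "norm (T t f - f) \<le> 1 / 2 * norm f" if "0 \<le> t" "t \<le> \<delta>" for t f
    using \<delta>'(1) \<delta>'(2)[of t f] that by (cases "f = 0"; cases "t = 0") (auto simp: T_zero \<delta>_def)
  \<comment> \<open>Beyond \<delta> the constant 2/\<delta> already follows from nonexpansiveness;
    the real work is for shorter times.\<close>
  have "norm (T t f - f) \<le> 2 / \<delta> * t * norm f" if t: "0 \<le> t" for t f
  proof (cases "t = 0 \<or> \<delta> < t")
    case True
    have "norm (T t f - f) \<le> norm f + norm f"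
      using norm_triangle_ineq4[of "T t f" f] T_norm_le[OF t, of f] by linarith
    also have "\<dots> \<le> 2 * (t / \<delta>) * norm f" if "\<delta> < t"
    proof -
      have "1 * norm f \<le> (t / \<delta>) * norm f"
        using that \<delta> by (intro mult_right_mono) auto
      then show ?thesis by simp
    qed
    finally show ?thesis using True by auto
  next
    case False
    with t have t: "0 < t" "t \<le> \<delta>" by auto
    obtain n :: nat where n: "0 < n" "n * t \<le> \<delta>" "\<delta> \<le> n * t + t"
      using t by (rule real_div_with_remainder)
    have le: "real k * t \<le> \<delta>" if "k \<le> n" for k
    proof -
      have "real k * t \<le> real n * t" using that t by simp
      also note n(2)
      finally show ?thesis .
    qed
    \<comment> \<open>\<open>E = \<epsilon>\<^sub>t\<close> is finite, so \<open>n E \<le> 1/2 + n E / 2\<close> can be solved for \<open>n E\<close>.\<close>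
    define E where "E = (SUP f\<in>{f. f \<noteq> 0}. norm (T t f - f) / norm f)"
    have bdd: "bdd_above ((\<lambda>f. norm (T t f - f) / norm f) ` {f. f \<noteq> 0})"
      using half[of t] t by (intro bdd_aboveI2[of _ _ "1 / 2"]) (auto simp: pos_divide_le_eq)
    show ?thesis
    proof (cases "f = 0")
      case f: False
      have E: "norm (T t g - g) \<le> E * norm g" for g
        using cSUP_upper[OF _ bdd, of g] t
        by (cases "g = 0") (auto simp: E_def pos_divide_le_eq T_zero)
      have E0: "0 \<le> E"
        using E[of f] f by (smt (verit) mult_neg_pos norm_ge_zero zero_less_norm_iff)
      \<comment> \<open>The increment over \<open>n * t\<close> contributes the first 1/2. The
        telescoping defect contributes \<open>n * E / 2\<close>, its 1/2 bounding the displacements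
        at the intermediate times.\<close>
      have step: "n * norm (T t g - g) \<le> (1 / 2 + n * E / 2) * norm g" for g
      proof -
        have hg: "norm (T (real k * t) g - g) \<le> 1 / 2 * norm g" if "k \<le> n" for k
          using t le that by (intro half) auto
        have "norm ((T (n * t) g - g) - n *\<^sub>R (T t g - g)) \<le> n * (E * (1 / 2 * norm g))"
          using t hg by (intro increment_mult E E0) auto
        with hg[of n] have "norm (n *\<^sub>R (T t g - g)) \<le> 1 / 2 * norm g + n * (E * (1 / 2 * norm g))"
          using norm_triangle_ineq2[of "n *\<^sub>R (T t g - g)" "T (n * t) g - g"]
          by (simp add: norm_minus_commute)
        then have "n * norm (T t g - g) \<le> 1 / 2 * norm g + n * (E * (1 / 2 * norm g))"
          by simp
        then show ?thesis by (simp only: distrib_right) simp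
      qed
      have "E \<le> (1 / 2 + n * E / 2) / n"
        unfolding E_def
      proof (rule cSUP_least, unfold E_def[symmetric])
        fix g :: "'x bfun" assume "g \<in> {f. f \<noteq> 0}"
        with step[of g] n(1) show "norm (T t g - g) / norm g \<le> (1 / 2 + n * E / 2) / n"
          by (simp add: pos_divide_le_eq pos_le_divide_eq mult_ac)
      qed (use f in auto)
      then have nE: "n * E \<le> 1"
        using n(1) by (simp add: pos_le_divide_eq mult_ac)
      \<comment> \<open>Since \<open>n\<close> is at least 1, the remainder \<open>t\<close> is at
        most \<open>n * t\<close>, so \<delta> is at most \<open>2 * n * t\<close>.\<close>
      have "1 * t \<le> n * t"
        using n(1) t by (intro mult_right_mono) auto
      then have "\<delta> * E \<le> (2 * n * t) * E"
        using n(3) E0 by (intro mult_right_mono) auto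
      moreover have "t * (n * E) \<le> t * 1"
        using t nE by (intro mult_left_mono) auto
      ultimately have "\<delta> * E \<le> 2 * t" by (simp add: mult_ac)
      then have "E \<le> 2 / \<delta> * t"
        using \<delta> by (simp add: pos_le_divide_eq mult_ac)
      then show ?thesis
        using E[of f] by (meson mult_right_mono norm_ge_zero order_trans)
    qed (use t in \<open>simp add: T_zero\<close>)
  qed
  with \<delta> that[of "2 / \<delta>"] show thesis by simp
qed

section \<open>Difference quotients at zero and their limit\<close>

context
  fixes C :: real
  assumes C: "0 < C" and linear_bound: "\<And>t f. 0 \<le> t \<Longrightarrow> norm (T t f - f) \<le> C * t * norm f"
begin

definition quotient :: "real \<Rightarrow> 'x bop" where
  "quotient t f = (1 / t) *\<^sub>R (T t f - f)"

lemma quotient_scale: "0 < t \<Longrightarrow> t *\<^sub>R quotient t f = T t f - f"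
  by (simp add: quotient_def)

lemma quotient_add:
  assumes "0 < t"
  shows "quotient t (f + g) x \<le> quotient t f x + quotient t g x"
proof -
  have "T t (f + g) x - (f x + g x) \<le> (T t f x - f x) + (T t g x - g x)"
    using sublinear_transition_add[OF transition, of t f g x] assms by simp
  from divide_right_mono[OF this, of t] show ?thesis
    using assms by (simp add: quotient_def add_divide_distrib)
qed

text \<open>Take \<open>C * t\<close> for the one-step constant and
  \<open>C * (n * t) * norm f\<close> for the displacements in \<open>increment_mult\<close>.
  Division by \<open>n * t\<close> leaves a bound that depends on the longer time only.\<close>

lemma quotient_mult:
  assumes t: "0 < t" and n: "0 < n"
  shows "norm (quotient (real n * t) f - quotient t f) \<le> C\<^sup>2 * (n * t) * norm f"
proof -
  have "norm ((T (n * t) f - f) - n *\<^sub>R (T t f - f)) \<le> n * ((C * t) * (C * (n * t) * norm f))"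
  proof (rule increment_mult)
    show "\<forall>k<n. norm (T (real k * t) f - f) \<le> C * (n * t) * norm f"
    proof (intro allI impI)
      fix k assume "k < n"
      then have "C * (k * t) * norm f \<le> C * (n * t) * norm f"
        using C t by (intro mult_right_mono mult_left_mono) auto
      with linear_bound[of "k * t" f] show "norm (T (real k * t) f - f) \<le> C * (n * t) * norm f"
        using t by simp
    qed
  qed (use t C linear_bound in auto)
  moreover have "quotient (n * t) f - quotient t f
      = (1 / (n * t)) *\<^sub>R ((T (n * t) f - f) - n *\<^sub>R (T t f - f))"
    using t n by (simp add: quotient_def scaleR_diff_right)
  ultimately show ?thesis
    using t n by (simp add: pos_divide_le_eq power2_eq_square mult_ac)
qed

text \<open>A remainder of \<open>s\<close> modulo \<open>t\<close> costs at most
  \<open>C * t * norm f\<close> twice: once in replacing \<open>T s\<close> by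
  \<open>T (n * t)\<close>, once in the weight of \<open>quotient t f\<close>. For fixed
  \<open>s\<close> this cost vanishes with \<open>t\<close>.\<close>

lemma quotient_compare:
  assumes t: "0 < t" "t \<le> s"
  shows "norm (quotient s f - quotient t f) \<le> (C\<^sup>2 * s + 2 * C * t / s) * norm f"
proof -
  obtain n :: nat where n: "0 < n" "n * t \<le> s" "s \<le> n * t + t"
    using t by (rule real_div_with_remainder)
  have s: "0 < s" using t by simp
  let ?u = "real n * t"
  have u: "0 < ?u" using n t by simp
  have "norm (T s f - T ?u f) \<le> C * \<bar>s - ?u\<bar> * norm f"
    using s u linear_bound by (intro T_diff_le) auto
  also have "\<dots> \<le> C * t * norm f"
    using C n by (intro mult_right_mono mult_left_mono) auto
  finally have 1: "norm (T s f - T ?u f) \<le> C * t * norm f" .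
  have 2: "norm (?u *\<^sub>R (quotient ?u f - quotient t f)) \<le> s * (C\<^sup>2 * s * norm f)"
  proof -
    have "norm (quotient ?u f - quotient t f) \<le> C\<^sup>2 * ?u * norm f"
      by (rule quotient_mult) (use t n in auto)
    also have "\<dots> \<le> C\<^sup>2 * s * norm f"
      using n by (intro mult_right_mono mult_left_mono) auto
    finally show ?thesis
      using u n by (auto intro!: mult_mono)
  qed
  have 3: "norm ((s - ?u) *\<^sub>R quotient t f) \<le> C * t * norm f"
  proof -
    have "norm (quotient t f) \<le> C * norm f"
      using linear_bound[of t f] t by (simp add: quotient_def pos_divide_le_eq mult_ac)
    then have "norm ((s - ?u) *\<^sub>R quotient t f) \<le> t * (C * norm f)"
      using n t by (auto intro!: mult_mono)
    then show ?thesis by (simp add: mult_ac)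
  qed
  have "s *\<^sub>R (quotient s f - quotient t f) = (T s f - T ?u f)
      + ?u *\<^sub>R (quotient ?u f - quotient t f) - (s - ?u) *\<^sub>R quotient t f"
    using quotient_scale[OF s, of f] quotient_scale[OF u, of f]
    by (simp add: scaleR_diff_right scaleR_diff_left)
  then have "norm (s *\<^sub>R (quotient s f - quotient t f))
      \<le> C * t * norm f + s * (C\<^sup>2 * s * norm f) + C * t * norm f"
    using norm_triangle_le_diff[OF add_mono[OF norm_triangle_mono[OF 1 2] 3]] by simp
  also have "norm (s *\<^sub>R (quotient s f - quotient t f)) = norm (quotient s f - quotient t f) * s"
    using s by simp
  also have "C * t * norm f + s * (C\<^sup>2 * s * norm f) + C * t * norm f
      = (C\<^sup>2 * s + 2 * C * t / s) * norm f * s"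
    using s by (simp add: field_simps)
  finally have "norm (quotient s f - quotient t f) * s \<le> (C\<^sup>2 * s + 2 * C * t / s) * norm f * s" .
  then show ?thesis
    using s by (simp only: mult_le_cancel_right_pos)
qed

text \<open>Each dyadic time is an integer multiple of all later ones, so
  \<open>quotient_mult\<close> yields the Cauchy property directly;
  \<open>quotient_minus_rate\<close> later covers all positive times.\<close>

definition rate :: "'x bop" where
  "rate f = lim (\<lambda>n. quotient ((1 / 2) ^ n) f)"

lemma quotient_tendsto_rate: "(\<lambda>n. quotient ((1 / 2) ^ n) f) \<longlonglongrightarrow> rate f"
proof -
  let ?q = "\<lambda>n. quotient ((1 / 2 :: real) ^ n) f"
  have dyadic: "norm (?q m - ?q n) \<le> C\<^sup>2 * (1 / 2) ^ m * norm f" if "m \<le> n" for m n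
  proof -
    have "real (2 ^ (n - m)) * (1 / 2) ^ n = (1 / 2) ^ m"
      using that by (auto simp: le_iff_add power_add power_divide)
    with quotient_mult[of "(1 / 2) ^ n" "2 ^ (n - m)" f] show ?thesis by simp
  qed
  have lim: "(\<lambda>m. C\<^sup>2 * (1 / 2) ^ m * norm f) \<longlonglongrightarrow> 0"
    by (auto intro!: tendsto_eq_intros)
  have "Cauchy ?q"
  proof (rule CauchyI')
    fix e :: real assume "0 < e"
    from order_tendstoD(2)[OF lim this]
    obtain M where M: "C\<^sup>2 * (1 / 2) ^ m * norm f < e" if "M \<le> m" for m
      by (auto simp: eventually_sequentially)
    have "norm (?q m - ?q n) < e" if "M \<le> m" "m < n" for m n
      using dyadic[of m n] M[of m] that by simp
    then show "\<exists>M. \<forall>m\<ge>M. \<forall>n>m. dist (?q m) (?q n) < e"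
      unfolding dist_norm by blast
  qed
  then show ?thesis
    unfolding rate_def by (simp add: Cauchy_convergent convergent_LIMSEQ_iff[symmetric])
qed

lemma quotient_tendsto_rate_apply: "(\<lambda>n. quotient ((1 / 2) ^ n) f x) \<longlonglongrightarrow> rate f x"
  using tendsto_bcontfun_uniform_limit[OF quotient_tendsto_rate] by (rule tendsto_uniform_limitI) simp

text \<open>This is \<open>quotient_compare\<close> with \<open>s\<close> fixed and \<open>t\<close>
  running through the dyadic times to \<open>0\<close>, where the remainder term disappears.\<close>

lemma quotient_minus_rate:
  assumes s: "0 < s"
  shows "norm (quotient s f - rate f) \<le> C\<^sup>2 * s * norm f"
proof (rule tendsto_le[OF sequentially_bot])
  let ?t = "\<lambda>n. (1 / 2 :: real) ^ n"
  show "(\<lambda>n. norm (quotient s f - quotient (?t n) f)) \<longlonglongrightarrow> norm (quotient s f - rate f)"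
    by (intro tendsto_intros quotient_tendsto_rate)
  show "(\<lambda>n. (C\<^sup>2 * s + 2 * C * ?t n / s) * norm f) \<longlonglongrightarrow> C\<^sup>2 * s * norm f"
    using s by (auto intro!: tendsto_eq_intros)
  have "?t \<longlonglongrightarrow> 0" by (auto intro!: tendsto_eq_intros)
  from order_tendstoD(2)[OF this s]
  show "\<forall>\<^sub>F n in sequentially.
      norm (quotient s f - quotient (?t n) f) \<le> (C\<^sup>2 * s + 2 * C * ?t n / s) * norm f"
    by eventually_elim (rule quotient_compare, auto)
qed

text \<open>The local error estimate required by \<open>euler_error\<close>, with
  \<open>D = C\<^sup>2\<close>.\<close>

lemma T_minus_euler_rate:
  assumes "0 \<le> h"
  shows "norm (T h f - (f + h *\<^sub>R rate f)) \<le> C\<^sup>2 * h\<^sup>2 * norm f"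
proof (cases "h = 0")
  case False
  with assms have h: "0 < h" by simp
  have "T h f - (f + h *\<^sub>R rate f) = h *\<^sub>R (quotient h f - rate f)"
    using h by (simp add: quotient_def algebra_simps)
  also have "norm \<dots> = h * norm (quotient h f - rate f)"
    using h by simp
  also have "\<dots> \<le> h * (C\<^sup>2 * h * norm f)"
    using h by (intro mult_left_mono quotient_minus_rate) auto
  finally show ?thesis by (simp add: power2_eq_square mult_ac)
qed simp

lemma rate_norm_le: "norm (rate f) \<le> C * norm f"
proof (rule tendsto_upperbound)
  show "(\<lambda>n. norm (quotient ((1 / 2) ^ n) f)) \<longlonglongrightarrow> norm (rate f)"
    by (intro tendsto_intros quotient_tendsto_rate)
  have "norm (quotient t f) \<le> C * norm f" if "0 < t" for t
    using linear_bound[of t f] that by (simp add: quotient_def pos_divide_le_eq mult_ac)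
  then show "\<forall>\<^sub>F n in sequentially. norm (quotient ((1 / 2) ^ n) f) \<le> C * norm f"
    by simp
qed simp

text \<open>Each property already holds for the quotients and survives the limit. At a maximum point
  of \<open>f\<close>, \<open>T t f x\<close> is at most \<open>f x\<close>, which gives the sign
  condition.\<close>

lemma sublinear_rate_op_rate: "sublinear_rate_op rate"
  unfolding sublinear_rate_op_def
proof (intro conjI allI impI)
  fix f :: "'x bfun" and c :: real assume "0 \<le> c"
  then have "quotient ((1 / 2) ^ n) (c *\<^sub>R f) = c *\<^sub>R quotient ((1 / 2) ^ n) f" for n
    using transition[of "(1 / 2) ^ n"]
    by (simp add: quotient_def sublinear_transition_op_def scaleR_diff_right)
  then have "(\<lambda>n. quotient ((1 / 2) ^ n) (c *\<^sub>R f)) \<longlonglongrightarrow> c *\<^sub>R rate f"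
    by (auto intro!: tendsto_intros quotient_tendsto_rate)
  with quotient_tendsto_rate show "rate (c *\<^sub>R f) = c *\<^sub>R rate f"
    by (rule LIMSEQ_unique)
next
  fix f g :: "'x bfun" and x
  show "rate (f + g) x \<le> rate f x + rate g x"
  proof (rule LIMSEQ_le[OF quotient_tendsto_rate_apply])
    show "(\<lambda>n. quotient ((1 / 2) ^ n) f x + quotient ((1 / 2) ^ n) g x) \<longlonglongrightarrow> rate f x + rate g x"
      by (intro tendsto_intros quotient_tendsto_rate_apply)
    show "\<exists>N. \<forall>n\<ge>N. quotient ((1 / 2) ^ n) (f + g) x
        \<le> quotient ((1 / 2) ^ n) f x + quotient ((1 / 2) ^ n) g x"
      using quotient_add by simp
  qed
next
  fix c :: real
  have "quotient ((1 / 2) ^ n) (const_bcontfun c) = 0" for n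
    by (simp add: quotient_def sublinear_transition_const[OF transition])
  then have "(\<lambda>n. quotient ((1 / 2) ^ n) (const_bcontfun c)) \<longlonglongrightarrow> 0"
    by simp
  with quotient_tendsto_rate show "rate (const_bcontfun c) = 0"
    by (rule LIMSEQ_unique)
next
  fix f :: "'x bfun" and x assume "(SUP y. f y) = f x \<and> 0 \<le> f x"
  then have "quotient ((1 / 2) ^ n) f x \<le> 0" for n
    using sublinear_transition_le_SUP[OF transition, of "(1 / 2) ^ n" f x]
    by (simp add: quotient_def divide_le_0_iff)
  then show "rate f x \<le> 0"
    by (intro LIMSEQ_le_const2[OF quotient_tendsto_rate_apply]) blast
qed

lemma rate_zero: "rate 0 = 0"
  using rate_norm_le[of 0] by simp

lemma lipschitz_map_rate: "lipschitz_map rate C"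
proof
  show "norm (rate f - rate g) \<le> C * norm (f - g)" for f g
    using sublinear_rate_op_rate rate_norm_le
    by (intro subadditive_op_lipschitz) (auto simp: sublinear_rate_op_def)
qed (use C rate_zero in auto)

lemma op_bounded_rate: "op_bounded rate"
proof -
  have "op_norm_b rate \<le> ennreal C"
    using C by (intro op_norm_b_le rate_zero rate_norm_le) auto
  then have "op_norm_s rate \<le> ennreal C"
    by (simp add: op_norm_b_def rate_zero)
  then show ?thesis
    unfolding op_bounded_def by (rule order_le_less_trans) simp
qed

section \<open>Convergence of the Euler scheme\<close>

lemma euler_rate_tendsto:
  assumes t: "0 \<le> t"
  shows "op_tendsto (\<lambda>n. (\<lambda>f. f + (t / real n) *\<^sub>R rate f) ^^ n) (T t) sequentially"
proof (rule op_tendstoI)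
  interpret lipschitz_map rate C by (rule lipschitz_map_rate)
  \<comment> \<open>The \<open>n\<close> local errors \<open>C\<^sup>2 * (t / n)\<^sup>2\<close> add
    up to \<open>C\<^sup>2 * t\<^sup>2 / n\<close>, and the exponential bounds their
    amplification.\<close>
  let ?c = "\<lambda>n. C\<^sup>2 * t\<^sup>2 * exp (t * C) / real n"
  show "?c \<longlonglongrightarrow> 0"
    by (rule lim_const_over_n)
  show "\<forall>\<^sub>F n in sequentially. (euler (t / real n) ^^ n) 0 = T t 0 \<and> 0 \<le> ?c n \<and>
      (\<forall>f. norm ((euler (t / real n) ^^ n) f - T t f) \<le> ?c n * norm f)"
    using eventually_gt_at_top[of 0]
  proof eventually_elim
    case (elim n)
    have "norm ((euler (t / real n) ^^ n) f - T t f) \<le> ?c n * norm f" for f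
    proof -
      have h: "0 \<le> t / n" using t by simp
      have "norm ((T (t / n) ^^ n) f - (euler (t / n) ^^ n) f)
          \<le> n * (C\<^sup>2 * (t / n)\<^sup>2) * exp (n * (t / n) * C) * norm f"
        by (rule euler_error[OF h _ T_minus_euler_rate[OF h] T_norm_le[OF h]]) simp
      moreover have "T t = T (t / n) ^^ n"
        using T_mult[OF h, of n] elim by simp
      ultimately show ?thesis
        using elim by (simp add: norm_minus_commute power2_eq_square field_simps)
    qed
    then show ?case
      using t by (simp add: euler_pow_zero T_zero)
  qed
qed

lemma exponential_rate: "exponential_semigroup_of rate T"
  unfolding exponential_semigroup_of_def
proof (intro allI impI conjI)
  fix t :: real assume t: "0 \<le> t"
  show lim: "op_tendsto (\<lambda>n. (\<lambda>f. f + (t / real n) *\<^sub>R rate f) ^^ n) (T t) sequentially"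
    using t by (rule euler_rate_tendsto)
  show "T t = op_exp (\<lambda>f. t *\<^sub>R rate f)"
    using op_lim_eq[OF lim] by (simp add: op_exp_def)
qed

end

end

theorem theorem3:
  fixes T :: "real \<Rightarrow> ('x::countable) bop"
  assumes "op_semigroup T"
    and "\<forall>t\<ge>0. sublinear_transition_op (T t)"
  shows "(uniformly_continuous_semigroup T \<longleftrightarrow>
           (\<exists>Q. sublinear_rate_op Q \<and> op_bounded Q \<and> exponential_semigroup_of Q T)) \<and>
         (\<forall>Q. sublinear_rate_op Q \<and> op_bounded Q \<and> exponential_semigroup_of Q T \<longrightarrow>
           op_tendsto (\<lambda>t f. (1 / t) *\<^sub>R (T t f - f)) Q (at_right 0))"
proof -
  interpret sublinear_semigroup T
    using assms by unfold_locales auto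
  have "\<exists>Q. sublinear_rate_op Q \<and> op_bounded Q \<and> exponential_semigroup_of Q T"
    if "uniformly_continuous_semigroup T"
  proof -
    from uniformly_continuous_imp_linear_bound[OF that]
    obtain C where C: "0 < C" "\<And>t f. 0 \<le> t \<Longrightarrow> norm (T t f - f) \<le> C * t * norm f"
      by blast
    show ?thesis
      using sublinear_rate_op_rate[OF C] op_bounded_rate[OF C] exponential_rate[OF C] by blast
  qed
  \<comment> \<open>Treating an arbitrary such \<open>Q\<close> serves both the converse implication
    and the formula for the rate operator.\<close>
  moreover have "uniformly_continuous_semigroup T \<and>
      op_tendsto (\<lambda>t f. (1 / t) *\<^sub>R (T t f - f)) Q (at_right 0)"
    if "sublinear_rate_op Q" "op_bounded Q" "exponential_semigroup_of Q T" for Q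
  proof -
    from sublinear_rate_op_lipschitz_map[OF that(1,2)] obtain L where "lipschitz_map Q L" .
    with exponential_uniformly_continuous[OF that(3)] exponential_derivative[OF that(3)]
    show ?thesis by blast
  qed
  ultimately show ?thesis by blast
qed

end
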